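(* An immersion $\iota:(M^m,g)\to(N^n,h)$ between Riemannian manifolds is infinity-harmonic if and only if the energy density of $\iota$ is constant. In particular, a conformal immersion is infinity-harmonic if and only if it is a homothetic immersion.
   Context: A $C^2$ map $\psi:(M,g)\to(N,h)$ between Riemannian manifolds is infinity-harmonic if $\frac12\, d\psi(\mathrm{grad}\,|d\psi|^2)=0$, where $|d\psi|_x^2=\sum_i h(d\psi(e_i),d\psi(e_i))$ for an orthonormal basis $\{e_i\}$ of $T_xM$; the function $|d\psi|^2$ is called the energy density of $\psi$. A conformal immersion is an immersion $\iota$ with $\iota^*h=\lambda^2 g$ for a positive function $\lambda$ on $M$; it is homothetic if $\lambda$ is constant.
   Formalization: M is assumed connected (and of positive dimension): on a disconnected M the claim fails, e.g. x and 2x on two disjoint copies of the real line is an infinity-harmonic conformal immersion into the line with energy density 1 and 4, not constant. *)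

theory Defs
  imports "HOL-Analysis.Analysis"
begin

text \<open>
  The class \<open>C\<^sup>k\<close> on an open set \<open>S\<close>. On open \<open>S\<close> the
  clause for \<^term>\<open>Suc k\<close> says that \<open>f\<close> is differentiable and that all its directional
  derivatives are of class \<open>C\<^sup>k\<close>. All uses below are on open sets.
\<close>

primrec Ck_on :: "nat \<Rightarrow> ('a::real_normed_vector \<Rightarrow> 'b::real_normed_vector) \<Rightarrow> 'a set \<Rightarrow> bool" where
  "Ck_on 0 f S \<longleftrightarrow> continuous_on S f"
| "Ck_on (Suc k) f S \<longleftrightarrow>
     (\<forall>x\<in>S. f differentiable (at x)) \<and> (\<forall>v. Ck_on k (\<lambda>x. frechet_derivative f (at x) v) S)"

definition smooth_on :: "('a::real_normed_vector \<Rightarrow> 'b::real_normed_vector) \<Rightarrow> 'a set \<Rightarrow> bool" where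
  "smooth_on f S \<longleftrightarrow> (\<forall>k. Ck_on k f S)"


text \<open>
  A chart is a pair \<open>(U, \<phi>)\<close>; the values of \<open>\<phi>\<close> outside \<open>U\<close> are irrelevant.
  A tangent vector at \<open>p\<close> is represented by the family of its coordinate vectors in
  all charts around \<open>p\<close>, extended by \<open>0\<close> to the remaining pairs. Its
  vector space operations are pointwise, and its zero is \<open>\<lambda>_. 0\<close>.
\<close>

type_synonym ('a, 'e) chart = "'a set \<times> ('a \<Rightarrow> 'e)"
type_synonym ('a, 'e) tangent = "('a, 'e) chart \<Rightarrow> 'e"

record ('a, 'e) riem =
  mtop :: "'a topology"
  atlas :: "('a, 'e) chart set"
  metric :: "'a \<Rightarrow> ('a, 'e) tangent \<Rightarrow> ('a, 'e) tangent \<Rightarrow> real"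

abbreviation points :: "('a, 'e) riem \<Rightarrow> 'a set" where
  "points M \<equiv> topspace (mtop M)"

abbreviation chart_dom :: "('a, 'e) chart \<Rightarrow> 'a set" where
  "chart_dom c \<equiv> fst c"

abbreviation chart_map :: "('a, 'e) chart \<Rightarrow> 'a \<Rightarrow> 'e" where
  "chart_map c \<equiv> snd c"

definition chart_inv :: "('a, 'e) chart \<Rightarrow> 'e \<Rightarrow> 'a" where
  "chart_inv c = inv_into (chart_dom c) (chart_map c)"

definition charts_at :: "('a, 'e) riem \<Rightarrow> 'a \<Rightarrow> ('a, 'e) chart set" where
  "charts_at M p = {c \<in> atlas M. p \<in> chart_dom c}"


text \<open>
  The topology of the manifold is required to be Hausdorff and second countable. The
  atlas need not be maximal, and the manifold need not be connected.
\<close>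

definition smooth_manifold :: "('a, 'e::euclidean_space) riem \<Rightarrow> bool" where
  "smooth_manifold M \<longleftrightarrow>
     Hausdorff_space (mtop M) \<and> second_countable (mtop M) \<and>
     (\<Union>c\<in>atlas M. chart_dom c) = points M \<and>
     (\<forall>c\<in>atlas M. openin (mtop M) (chart_dom c) \<and> open (chart_map c ` chart_dom c) \<and>
        homeomorphic_map (subtopology (mtop M) (chart_dom c))
          (top_of_set (chart_map c ` chart_dom c)) (chart_map c)) \<and>
     (\<forall>c\<in>atlas M. \<forall>d\<in>atlas M.
        smooth_on (chart_map d \<circ> chart_inv c) (chart_map c ` (chart_dom c \<inter> chart_dom d)))"

definition tangent_space :: "('a, 'e::euclidean_space) riem \<Rightarrow> 'a \<Rightarrow> ('a, 'e) tangent set" where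
  "tangent_space M p =
     {v. (\<forall>c\<in>charts_at M p. \<forall>d\<in>charts_at M p.
            v d = frechet_derivative (chart_map d \<circ> chart_inv c) (at (chart_map c p)) (v c)) \<and>
         (\<forall>c. c \<notin> charts_at M p \<longrightarrow> v c = 0)}"

text \<open>The tangent vector at \<open>p\<close> whose coordinate vector in the chart \<open>c\<close> around \<open>p\<close> is \<open>x\<close>.\<close>

definition coord_vector ::
    "('a, 'e::euclidean_space) riem \<Rightarrow> 'a \<Rightarrow> ('a, 'e) chart \<Rightarrow> 'e \<Rightarrow> ('a, 'e) tangent" where
  "coord_vector M p c x =
     (\<lambda>d. if d \<in> charts_at M p
          then frechet_derivative (chart_map d \<circ> chart_inv c) (at (chart_map c p)) x else 0)"

definition riemannian_manifold :: "('a, 'e::euclidean_space) riem \<Rightarrow> bool" where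
  "riemannian_manifold M \<longleftrightarrow>
     smooth_manifold M \<and>
     (\<forall>p\<in>points M.
        (\<forall>u\<in>tangent_space M p. \<forall>v\<in>tangent_space M p. metric M p u v = metric M p v u) \<and>
        (\<forall>u\<in>tangent_space M p. \<forall>v\<in>tangent_space M p. \<forall>w\<in>tangent_space M p.
           metric M p (\<lambda>c. u c + v c) w = metric M p u w + metric M p v w) \<and>
        (\<forall>a. \<forall>u\<in>tangent_space M p. \<forall>v\<in>tangent_space M p.
           metric M p (\<lambda>c. a *\<^sub>R u c) v = a * metric M p u v) \<and>
        (\<forall>u\<in>tangent_space M p. u \<noteq> (\<lambda>_. 0) \<longrightarrow> metric M p u u > 0)) \<and>
     (\<forall>c\<in>atlas M. \<forall>x y.
        smooth_on (\<lambda>z. metric M (chart_inv c z) (coord_vector M (chart_inv c z) c x)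
                                                 (coord_vector M (chart_inv c z) c y))
          (chart_map c ` chart_dom c))"


definition C2_map :: "('a, 'e::euclidean_space) riem \<Rightarrow> ('b, 'f::euclidean_space) riem \<Rightarrow> ('a \<Rightarrow> 'b) \<Rightarrow> bool" where
  "C2_map M N \<psi> \<longleftrightarrow>
     continuous_map (mtop M) (mtop N) \<psi> \<and>
     (\<forall>c\<in>atlas M. \<forall>d\<in>atlas N.
        Ck_on 2 (chart_map d \<circ> \<psi> \<circ> chart_inv c)
          (chart_map c ` {p \<in> chart_dom c. \<psi> p \<in> chart_dom d}))"

text \<open>
  The differentials below are computed in an arbitrary chart around \<open>p\<close>; for
  differentiable maps the chain rule makes them independent of this choice.
\<close>

definition some_chart :: "('a, 'e) riem \<Rightarrow> 'a \<Rightarrow> ('a, 'e) chart" where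
  "some_chart M p = (SOME c. c \<in> charts_at M p)"

definition differential ::
    "('a, 'e::euclidean_space) riem \<Rightarrow> ('b, 'f::euclidean_space) riem \<Rightarrow> ('a \<Rightarrow> 'b) \<Rightarrow> 'a
       \<Rightarrow> ('a, 'e) tangent \<Rightarrow> ('b, 'f) tangent" where
  "differential M N \<psi> p v =
     (let c = some_chart M p in
       (\<lambda>d. if d \<in> charts_at N (\<psi> p)
            then frechet_derivative (chart_map d \<circ> \<psi> \<circ> chart_inv c) (at (chart_map c p)) (v c)
            else 0))"

definition fun_differential ::
    "('a, 'e::euclidean_space) riem \<Rightarrow> ('a \<Rightarrow> real) \<Rightarrow> 'a \<Rightarrow> ('a, 'e) tangent \<Rightarrow> real" where
  "fun_differential M f p v =
     (let c = some_chart M p in frechet_derivative (f \<circ> chart_inv c) (at (chart_map c p)) (v c))"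

definition grad ::
    "('a, 'e::euclidean_space) riem \<Rightarrow> ('a \<Rightarrow> real) \<Rightarrow> 'a \<Rightarrow> ('a, 'e) tangent" where
  "grad M f p =
     (THE w. w \<in> tangent_space M p \<and>
        (\<forall>v\<in>tangent_space M p. metric M p w v = fun_differential M f p v))"


definition orthonormal_basis ::
    "('a, 'e::euclidean_space) riem \<Rightarrow> 'a \<Rightarrow> (nat \<Rightarrow> ('a, 'e) tangent) \<Rightarrow> bool" where
  "orthonormal_basis M p e \<longleftrightarrow>
     (\<forall>i<DIM('e). e i \<in> tangent_space M p) \<and>
     (\<forall>i<DIM('e). \<forall>j<DIM('e). metric M p (e i) (e j) = (if i = j then 1 else 0)) \<and>
     (\<forall>v\<in>tangent_space M p. \<exists>a. v = (\<lambda>c. \<Sum>i<DIM('e). a i *\<^sub>R e i c))"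

definition energy_density ::
    "('a, 'e::euclidean_space) riem \<Rightarrow> ('b, 'f::euclidean_space) riem \<Rightarrow> ('a \<Rightarrow> 'b) \<Rightarrow> 'a \<Rightarrow> real" where
  "energy_density M N \<psi> p =
     (let e = (SOME e. orthonormal_basis M p e) in
       \<Sum>i<DIM('e). metric N (\<psi> p) (differential M N \<psi> p (e i)) (differential M N \<psi> p (e i)))"

definition infinity_harmonic ::
    "('a, 'e::euclidean_space) riem \<Rightarrow> ('b, 'f::euclidean_space) riem \<Rightarrow> ('a \<Rightarrow> 'b) \<Rightarrow> bool" where
  "infinity_harmonic M N \<psi> \<longleftrightarrow>
     C2_map M N \<psi> \<and>
     (\<forall>p\<in>points M.
        (\<lambda>d. (1/2) *\<^sub>R differential M N \<psi> p (grad M (energy_density M N \<psi>) p) d) = (\<lambda>_. 0))"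


text \<open>
  Immersions are taken to be of class \<open>C\<^sup>2\<close>, the regularity at which
  infinity-harmonicity is defined; in particular smooth immersions are covered.
\<close>

definition immersion ::
    "('a, 'e::euclidean_space) riem \<Rightarrow> ('b, 'f::euclidean_space) riem \<Rightarrow> ('a \<Rightarrow> 'b) \<Rightarrow> bool" where
  "immersion M N \<iota> \<longleftrightarrow>
     C2_map M N \<iota> \<and> (\<forall>p\<in>points M. inj_on (differential M N \<iota> p) (tangent_space M p))"

definition conformal_with ::
    "('a, 'e::euclidean_space) riem \<Rightarrow> ('b, 'f::euclidean_space) riem \<Rightarrow> ('a \<Rightarrow> 'b) \<Rightarrow> ('a \<Rightarrow> real) \<Rightarrow> bool" where
  "conformal_with M N \<iota> l \<longleftrightarrow>
     (\<forall>p\<in>points M. l p > 0 \<and>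
        (\<forall>u\<in>tangent_space M p. \<forall>v\<in>tangent_space M p.
           metric N (\<iota> p) (differential M N \<iota> p u) (differential M N \<iota> p v)
             = (l p)\<^sup>2 * metric M p u v))"

definition conformal_immersion ::
    "('a, 'e::euclidean_space) riem \<Rightarrow> ('b, 'f::euclidean_space) riem \<Rightarrow> ('a \<Rightarrow> 'b) \<Rightarrow> bool" where
  "conformal_immersion M N \<iota> \<longleftrightarrow> immersion M N \<iota> \<and> (\<exists>l. conformal_with M N \<iota> l)"

definition homothetic_immersion ::
    "('a, 'e::euclidean_space) riem \<Rightarrow> ('b, 'f::euclidean_space) riem \<Rightarrow> ('a \<Rightarrow> 'b) \<Rightarrow> bool" where
  "homothetic_immersion M N \<iota> \<longleftrightarrow> immersion M N \<iota> \<and> (\<exists>r. conformal_with M N \<iota> (\<lambda>_. r))"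

end

theory Submission
  imports Defs
begin

text \<open>
  Let \<open>E\<close> be the energy density of the immersion. The defining equation says that the
  differential of the immersion annihilates \<open>grad E\<close>. As this differential is injective at
  every point, the equation is equivalent to \<open>grad E = 0\<close>, hence to the vanishing of the
  derivative of \<open>E\<close> in all charts, and on a connected manifold this means that \<open>E\<close> is
  constant (\<open>grad_zero_iff_constant\<close>). If the immersion is conformal with factor \<open>\<lambda>\<close>, then
  \<open>E = m \<lambda>\<^sup>2\<close> with \<open>m\<close> the dimension of the domain (\<open>energy_density_conformal\<close>), so that
  \<open>E\<close> is constant exactly when the positive function \<open>\<lambda>\<close> is.

  The step that needs work is the differentiability of \<open>E\<close>
  (\<open>energy_density_differentiable\<close>), since \<open>E\<close> is defined through an unrelated choice of
  orthonormal basis at each point. It is the trace of the pulled back metric, so it does not depend on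
  these bases (\<open>trace_frame_independent\<close>), and Gram-Schmidt applied in a chart provides
  orthonormal bases that depend differentiably on the point
  (\<open>differentiable_orthonormal_frame\<close>). In such bases \<open>E\<close> is a finite sum of expressions built
  from the metric coefficients of the target, which are smooth, and the first derivatives of the
  immersion, which are differentiable because it is of class \<open>C\<^sup>2\<close>.
\<close>

section \<open>Orthonormal frames and traces\<close>

text \<open>An inner product on \<open>'e\<close>, in general different from the one that comes with the type.\<close>

definition inner_form :: "('e::euclidean_space \<Rightarrow> 'e \<Rightarrow> real) \<Rightarrow> bool" where
  "inner_form B \<longleftrightarrow> bilinear B \<and> (\<forall>x y. B x y = B y x) \<and> (\<forall>x. x \<noteq> 0 \<longrightarrow> B x x > 0)"

text \<open>A basis of the whole space, indexed by \<open>{..<DIM('e)}\<close>, that is orthonormal for \<open>B\<close>.\<close>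

definition orthonormal_frame ::
    "('e::euclidean_space \<Rightarrow> 'e \<Rightarrow> real) \<Rightarrow> (nat \<Rightarrow> 'e) \<Rightarrow> bool" where
  "orthonormal_frame B e \<longleftrightarrow>
     (\<forall>i<DIM('e). \<forall>j<DIM('e). B (e i) (e j) = (if i = j then 1 else 0)) \<and>
     span (e ` {..<DIM('e)}) = UNIV"

lemma bilinear_left_sum:
  assumes "bilinear B"
  shows "B (sum f A) y = (\<Sum>i\<in>A. B (f i) y)"
proof -
  interpret linear "\<lambda>x. B x y" using assms by (simp add: bilinear_def)
  show ?thesis by (rule sum)
qed

lemma bilinear_right_sum:
  assumes "bilinear B"
  shows "B x (sum f A) = (\<Sum>i\<in>A. B x (f i))"
proof -
  interpret linear "\<lambda>y. B x y" using assms by (simp add: bilinear_def)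
  show ?thesis by (rule sum)
qed

lemma orthonormal_frame_expansion:
  fixes B :: "'e::euclidean_space \<Rightarrow> 'e \<Rightarrow> real"
  assumes B: "bilinear B" and e: "orthonormal_frame B e"
  shows "x = (\<Sum>i<DIM('e). B x (e i) *\<^sub>R e i)"
proof -
  let ?P = "\<lambda>x. x = (\<Sum>i<DIM('e). B x (e i) *\<^sub>R e i)"
  have "x \<in> span (e ` {..<DIM('e)})" using e by (simp add: orthonormal_frame_def)
  then show "?P x"
  proof (induction rule: span_induct)
    case (step x)
    then obtain j where j: "j < DIM('e)" "x = e j" by auto
    have "(\<Sum>i<DIM('e). B x (e i) *\<^sub>R e i) = (\<Sum>i<DIM('e). (if j = i then e i else 0))"
      using e j by (intro sum.cong) (auto simp: orthonormal_frame_def)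
    then show ?case using j by simp
  next
    case base
    have *: "?P 0" by (simp add: bilinear_lzero[OF B])
    have **: "?P (u + v)" if "?P u" "?P v" for u v
      by (subst that(1), subst that(2))
         (simp add: bilinear_ladd[OF B] scaleR_add_left sum.distrib)
    have ***: "?P (a *\<^sub>R u)" if "?P u" for u a
      by (subst that) (simp add: bilinear_lmul[OF B] scaleR_sum_right)
    show ?case
      unfolding subspace_def mem_Collect_eq using * ** *** by blast
  qed
qed

text \<open>
  Expand each \<open>e i\<close> in the frame \<open>f\<close>; by Parseval's identity for \<open>e\<close> the matrix of
  coefficients is orthogonal.
\<close>

lemma trace_frame_independent:
  fixes B H :: "'e::euclidean_space \<Rightarrow> 'e \<Rightarrow> real"
  assumes B: "inner_form B" and H: "bilinear H"
    and e: "orthonormal_frame B e" and f: "orthonormal_frame B f"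
  shows "(\<Sum>i<DIM('e). H (e i) (e i)) = (\<Sum>i<DIM('e). H (f i) (f i))"
proof -
  have bil: "bilinear B" and sym: "\<And>x y. B x y = B y x" using B by (auto simp: inner_form_def)
  have parseval: "(\<Sum>i<DIM('e). B (e i) x * B (e i) y) = B x y" for x y
  proof -
    have "B x y = B (\<Sum>i<DIM('e). B x (e i) *\<^sub>R e i) y"
      using orthonormal_frame_expansion[OF bil e, of x] by simp
    also have "\<dots> = (\<Sum>i<DIM('e). B x (e i) * B (e i) y)"
      by (simp add: bilinear_left_sum[OF bil] bilinear_lmul[OF bil])
    finally show ?thesis by (simp add: sym[of x])
  qed
  have "H (e i) (e i) = (\<Sum>j<DIM('e). \<Sum>k<DIM('e). B (e i) (f j) * B (e i) (f k) * H (f j) (f k))"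
    for i
  proof -
    have "H (e i) (e i) = H (\<Sum>j<DIM('e). B (e i) (f j) *\<^sub>R f j) (\<Sum>k<DIM('e). B (e i) (f k) *\<^sub>R f k)"
      using orthonormal_frame_expansion[OF bil f, of "e i"] by simp
    also have "\<dots> = (\<Sum>j<DIM('e). \<Sum>k<DIM('e). B (e i) (f j) * B (e i) (f k) * H (f j) (f k))"
      unfolding bilinear_left_sum[OF H] bilinear_lmul[OF H]
      unfolding bilinear_right_sum[OF H] bilinear_rmul[OF H]
      by (simp add: sum_distrib_left mult.assoc)
    finally show ?thesis .
  qed
  then have "(\<Sum>i<DIM('e). H (e i) (e i)) =
      (\<Sum>i<DIM('e). \<Sum>j<DIM('e). \<Sum>k<DIM('e). B (e i) (f j) * B (e i) (f k) * H (f j) (f k))"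
    by simp
  also have "\<dots> = (\<Sum>j<DIM('e). \<Sum>i<DIM('e). \<Sum>k<DIM('e). B (e i) (f j) * B (e i) (f k) * H (f j) (f k))"
    by (rule sum.swap)
  also have "\<dots> = (\<Sum>j<DIM('e). \<Sum>k<DIM('e). \<Sum>i<DIM('e). B (e i) (f j) * B (e i) (f k) * H (f j) (f k))"
    by (rule sum.cong[OF refl], rule sum.swap)
  also have "\<dots> = (\<Sum>j<DIM('e). \<Sum>k<DIM('e). B (f j) (f k) * H (f j) (f k))"
    by (simp add: parseval flip: sum_distrib_right)
  also have "\<dots> = (\<Sum>j<DIM('e). \<Sum>k<DIM('e). if j = k then H (f j) (f k) else 0)"
    using f by (intro sum.cong refl) (auto simp: orthonormal_frame_def)
  also have "\<dots> = (\<Sum>j<DIM('e). H (f j) (f j))"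
    by simp
  finally show ?thesis .
qed

section \<open>Differentiable dependence on a parameter\<close>

lemma differentiable_transform_open:
  assumes "f differentiable (at z)" "open W" "z \<in> W" "\<And>w. w \<in> W \<Longrightarrow> f w = g w"
  shows "g differentiable (at z)"
  using assms has_derivative_transform_within_open unfolding differentiable_def by blast

lemma differentiable_inner_const:
  assumes "X differentiable (at z)"
  shows "(\<lambda>w. X w \<bullet> b) differentiable (at z)"
  using assms unfolding differentiable_def by (blast intro: has_derivative_inner_left)

text \<open>
  Differentiability of a family of linear maps is only required pointwise, for each fixed
  argument; in finite dimension this suffices for arguments that vary as well.
\<close>

lemma differentiable_linear_apply:
  fixes X :: "'c::real_normed_vector \<Rightarrow> 'e::euclidean_space"
    and L :: "'c \<Rightarrow> 'e \<Rightarrow> 'v::real_normed_vector"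
  assumes W: "open W" "z \<in> W"
    and lin: "\<And>w. w \<in> W \<Longrightarrow> linear (L w)"
    and L: "\<And>x. (\<lambda>w. L w x) differentiable (at z)"
    and X: "X differentiable (at z)"
  shows "(\<lambda>w. L w (X w)) differentiable (at z)"
proof (rule differentiable_transform_open[OF _ W])
  show "(\<lambda>w. \<Sum>b\<in>Basis. (X w \<bullet> b) *\<^sub>R L w b) differentiable (at z)"
    by (intro differentiable_sum ballI differentiable_scaleR differentiable_inner_const X L finite_Basis)
  fix w assume "w \<in> W"
  then interpret linear "L w" by (rule lin)
  have "L w (X w) = L w (\<Sum>b\<in>Basis. (X w \<bullet> b) *\<^sub>R b)" by (simp add: euclidean_representation)
  then show "(\<Sum>b\<in>Basis. (X w \<bullet> b) *\<^sub>R L w b) = L w (X w)"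
    by (simp add: sum scale)
qed

lemma differentiable_bilinear_apply:
  fixes X Y :: "'c::real_normed_vector \<Rightarrow> 'e::euclidean_space"
    and B :: "'c \<Rightarrow> 'e \<Rightarrow> 'e \<Rightarrow> real"
  assumes W: "open W" "z \<in> W"
    and bil: "\<And>w. w \<in> W \<Longrightarrow> bilinear (B w)"
    and B: "\<And>x y. (\<lambda>w. B w x y) differentiable (at z)"
    and X: "X differentiable (at z)" and Y: "Y differentiable (at z)"
  shows "(\<lambda>w. B w (X w) (Y w)) differentiable (at z)"
proof (rule differentiable_linear_apply[OF W _ _ Y])
  show "linear (B w (X w))" if "w \<in> W" for w
    using bil[OF that] by (simp add: bilinear_def)
  show "(\<lambda>w. B w (X w) y) differentiable (at z)" for y
    by (rule differentiable_linear_apply[OF W _ _ X, where L = "\<lambda>w x. B w x y"])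
       (use bil B in \<open>auto simp: bilinear_def\<close>)
qed

text \<open>
  Gram-Schmidt with parameters: the frame obtained from a fixed basis depends
  differentiably on the parameter as soon as the inner product does.
\<close>

lemma differentiable_orthonormal_frame:
  fixes B :: "'c::real_normed_vector \<Rightarrow> 'e::euclidean_space \<Rightarrow> 'e \<Rightarrow> real"
  assumes W: "open W"
    and form: "\<And>w. w \<in> W \<Longrightarrow> inner_form (B w)"
    and diff: "\<And>w x y. w \<in> W \<Longrightarrow> (\<lambda>w. B w x y) differentiable (at w)"
  obtains e where "\<forall>w\<in>W. orthonormal_frame (B w) (\<lambda>i. e i w)"
    and "\<forall>i<DIM('e). \<forall>w\<in>W. e i differentiable (at w)"
proof -
  have "card {..<DIM('e)} = card (Basis::'e set)" by simp
  then obtain b where b: "bij_betw b {..<DIM('e)} (Basis::'e set)"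
    using finite_same_card_bij[OF finite_lessThan finite_Basis] by blast
  have bil: "bilinear (B w)" and sym: "B w x y = B w y x"
    and pos: "x \<noteq> 0 \<Longrightarrow> B w x x > 0" if "w \<in> W" for w x y
    using form[OF that] by (auto simp: inner_form_def)
  have indep: "b n \<notin> span (b ` {..<n})" if "n < DIM('e)" for n
  proof
    assume *: "b n \<in> span (b ` {..<n})"
    have "inj_on b {..<DIM('e)}" "b ` {..<DIM('e)} = Basis"
      using b by (auto simp: bij_betw_def)
    then have "b n \<in> Basis" "b ` {..<n} \<subseteq> Basis - {b n}"
      using that by (auto dest: inj_onD)
    then have "b n \<in> span (Basis - {b n})" using * span_mono by blast
    then show False using \<open>b n \<in> Basis\<close> independent_Basis dependent_def by blast
  qed
  \<comment> \<open>The first \<open>n\<close> vectors of the frame have the same span as the first \<open>n\<close> basis vectors, so the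
    next basis vector is never in the span of the frame vectors already constructed.\<close>
  have "\<exists>e. (\<forall>i<n. \<forall>w\<in>W. e i differentiable (at w)) \<and>
            (\<forall>w\<in>W. \<forall>i<n. \<forall>j<n. B w (e i w) (e j w) = (if i = j then 1 else 0)) \<and>
            (\<forall>w\<in>W. span ((\<lambda>i. e i w) ` {..<n}) = span (b ` {..<n}))"
    if "n \<le> DIM('e)" for n
    using that
  proof (induction n)
    case 0
    then show ?case by simp
  next
    case (Suc n)
    from Suc.IH[OF Suc_leD[OF Suc.prems]] obtain e where
      e: "\<forall>i<n. \<forall>w\<in>W. e i differentiable (at w)"
        "\<forall>w\<in>W. \<forall>i<n. \<forall>j<n. B w (e i w) (e j w) = (if i = j then 1 else 0)"
        "\<forall>w\<in>W. span ((\<lambda>i. e i w) ` {..<n}) = span (b ` {..<n})"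
      by blast
    have d: "e i differentiable (at w)" if "i < n" "w \<in> W" for i w
      using e(1) that by blast
    have o: "B w (e i w) (e j w) = (if i = j then 1 else 0)" if "w \<in> W" "i < n" "j < n" for i j w
      using e(2) that by blast
    have s: "span ((\<lambda>i. e i w) ` {..<n}) = span (b ` {..<n})" if "w \<in> W" for w
      using e(3) that by blast
    \<comment> \<open>\<open>p w\<close> is the projection of \<open>b n\<close> to the span of the frame vectors so far, \<open>f w\<close> the next
      frame vector.\<close>
    define p where "p = (\<lambda>w. \<Sum>j<n. B w (b n) (e j w) *\<^sub>R e j w)"
    define u where "u = (\<lambda>w. b n - p w)"
    define f where "f = (\<lambda>w. (1 / sqrt (B w (u w) (u w))) *\<^sub>R u w)"
    have p_span: "p w \<in> span ((\<lambda>i. e i w) ` {..<n})" for w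
      unfolding p_def by (intro span_sum span_scale span_base) auto
    have u0: "u w \<noteq> 0" if "w \<in> W" for w
    proof
      assume "u w = 0"
      then have "b n = p w" by (simp add: u_def)
      then show False using indep[of n] Suc.prems p_span[of w] s[OF that] by simp
    qed
    have upos: "B w (u w) (u w) > 0" if "w \<in> W" for w
      using pos[OF that] u0[OF that] by blast
    have u_orth: "B w (u w) (e i w) = 0" if "w \<in> W" "i < n" for w i
    proof -
      have "B w (p w) (e i w) = (\<Sum>j<n. B w (b n) (e j w) * (if j = i then 1 else 0))"
        unfolding p_def bilinear_left_sum[OF bil[OF that(1)]] bilinear_lmul[OF bil[OF that(1)]]
        using o that by (intro sum.cong) auto
      also have "\<dots> = (\<Sum>j<n. if j = i then B w (b n) (e j w) else 0)"
        by (intro sum.cong) auto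
      also have "\<dots> = B w (b n) (e i w)"
        using that by simp
      finally show ?thesis by (simp add: u_def bilinear_lsub[OF bil[OF that(1)]])
    qed
    have f_orth: "B w (f w) (e i w) = 0" if "w \<in> W" "i < n" for w i
      using u_orth[OF that] by (simp add: f_def bilinear_lmul[OF bil[OF that(1)]])
    have f_orth': "B w (e i w) (f w) = 0" if "w \<in> W" "i < n" for w i
      by (subst sym[OF that(1)]) (rule f_orth[OF that])
    have f_norm: "B w (f w) (f w) = 1" if "w \<in> W" for w
      using upos[OF that]
      by (simp add: f_def bilinear_lmul[OF bil[OF that]] bilinear_rmul[OF bil[OF that]])
    have udiff: "u differentiable (at w)" if "w \<in> W" for w
    proof -
      have "(\<lambda>w. B w (b n) (e j w)) differentiable (at w)" if "j < n" for j
        by (rule differentiable_bilinear_apply[OF W \<open>w \<in> W\<close> bil diff[OF \<open>w \<in> W\<close>]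
              differentiable_const d[OF that \<open>w \<in> W\<close>]])
      then show ?thesis
        unfolding u_def p_def using d that by simp
    qed
    have fdiff: "f differentiable (at w)" if "w \<in> W" for w
    proof -
      have *: "(\<lambda>w. B w (u w) (u w)) differentiable (at w)"
        by (rule differentiable_bilinear_apply[OF W that bil diff[OF that] udiff[OF that] udiff[OF that]])
      have "(\<lambda>x::real. 1 / sqrt x) differentiable (at (B w (u w) (u w)))"
      proof -
        have "((\<lambda>x::real. 1 / sqrt x) has_real_derivative
            - (inverse (sqrt (B w (u w) (u w))) / 2) / (sqrt (B w (u w) (u w)) * sqrt (B w (u w) (u w))))
            (at (B w (u w) (u w)))"
          using upos[OF that] by (auto intro!: derivative_eq_intros)
        then show ?thesis
          unfolding real_differentiable_def by blast
      qed
      from differentiable_compose[OF this *] show ?thesis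
        unfolding f_def using udiff[OF that] by (intro differentiable_scaleR)
    qed
    define e' where "e' = e(n := f)"
    have "span ((\<lambda>i. e' i w) ` {..<Suc n}) = span (b ` {..<Suc n})" if "w \<in> W" for w
    proof -
      let ?E = "(\<lambda>i. e i w) ` {..<n}"
      have im: "(\<lambda>i. e' i w) ` {..<Suc n} = insert (f w) ?E"
        by (auto simp: e'_def lessThan_Suc)
      have bn: "b n = sqrt (B w (u w) (u w)) *\<^sub>R f w + p w"
        using upos[OF that] by (simp add: f_def u_def)
      have 1: "span (insert (f w) ?E) = span (insert (b n) ?E)"
      proof (intro span_eq[THEN iffD2] conjI insert_subsetI)
        have p: "p w \<in> span (insert (b n) ?E)" "p w \<in> span (insert (f w) ?E)"
          using p_span[of w] span_mono[of ?E] by blast+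
        show "f w \<in> span (insert (b n) ?E)"
          unfolding f_def u_def by (intro span_scale span_diff p) (simp add: span_base)
        show "b n \<in> span (insert (f w) ?E)"
          unfolding bn by (intro span_add span_scale p) (simp add: span_base)
      qed (auto intro: span_base)
      have 2: "span (insert (b n) ?E) = span (insert (b n) (b ` {..<n}))"
        unfolding span_insert s[OF that] ..
      show ?thesis
        unfolding im 1 2 by (simp add: lessThan_Suc)
    qed
    then show ?case
      using d o f_orth f_orth' f_norm fdiff
      by (intro exI[of _ e']) (auto simp: e'_def less_Suc_eq)
  qed
  from this[OF order_refl] obtain e where
    "\<forall>i<DIM('e). \<forall>w\<in>W. e i differentiable (at w)"
    "\<forall>w\<in>W. \<forall>i<DIM('e). \<forall>j<DIM('e). B w (e i w) (e j w) = (if i = j then 1 else 0)"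
    "\<forall>w\<in>W. span ((\<lambda>i. e i w) ` {..<DIM('e)}) = span (b ` {..<DIM('e)})"
    by blast
  moreover have "span (b ` {..<DIM('e)}) = UNIV"
    using b by (simp add: bij_betw_def)
  ultimately show thesis
    using that[of e] by (simp add: orthonormal_frame_def)
qed

section \<open>Charts and tangent vectors in coordinates\<close>

lemma smooth_on_differentiable:
  "smooth_on f S \<Longrightarrow> z \<in> S \<Longrightarrow> f differentiable (at z)"
  unfolding smooth_on_def using Ck_on.simps(2) by blast

lemma Ck_on_2_differentiable:
  assumes "Ck_on 2 f S" "z \<in> S"
  shows "f differentiable (at z)" "(\<lambda>w. frechet_derivative f (at w) v) differentiable (at z)"
  using assms by (auto simp: numeral_2_eq_2)

lemma chart_inv_chart_map:
  assumes "smooth_manifold M" "c \<in> charts_at M p"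
  shows "chart_inv c (chart_map c p) = p"
proof -
  have c: "c \<in> atlas M" "p \<in> chart_dom c" using assms(2) by (auto simp: charts_at_def)
  then have "openin (mtop M) (chart_dom c)"
    and "homeomorphic_map (subtopology (mtop M) (chart_dom c))
          (top_of_set (chart_map c ` chart_dom c)) (chart_map c)"
    using assms(1) by (auto simp: smooth_manifold_def)
  then have "inj_on (chart_map c) (chart_dom c)"
    by (auto dest!: homeomorphic_imp_injective_map openin_subset simp: Int_absorb1)
  then show ?thesis using c by (simp add: chart_inv_def)
qed

lemma open_chart_image:
  assumes "smooth_manifold M" "c \<in> atlas M" "openin (mtop M) U" "U \<subseteq> chart_dom c"
  shows "open (chart_map c ` U)"
proof -
  have o: "openin (mtop M) (chart_dom c)" "open (chart_map c ` chart_dom c)"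
    and h: "homeomorphic_map (subtopology (mtop M) (chart_dom c))
          (top_of_set (chart_map c ` chart_dom c)) (chart_map c)"
    using assms(1,2) by (auto simp: smooth_manifold_def)
  have "openin (subtopology (mtop M) (chart_dom c)) U"
    using assms(3,4) by (simp add: openin_open_subtopology o)
  then have "openin (top_of_set (chart_map c ` chart_dom c)) (chart_map c ` U)"
    using homeomorphic_map_openness_eq[OF h] by blast
  then show ?thesis using o(2) openin_open_eq by blast
qed

lemma openin_chart_dom:
  "smooth_manifold M \<Longrightarrow> c \<in> atlas M \<Longrightarrow> openin (mtop M) (chart_dom c)"
  by (simp add: smooth_manifold_def)

lemma charts_at_nonempty:
  assumes "smooth_manifold M" "p \<in> points M"
  obtains c where "c \<in> charts_at M p"
proof -
  have "p \<in> (\<Union>c\<in>atlas M. chart_dom c)"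
    using assms by (simp add: smooth_manifold_def)
  then show thesis using that by (auto simp: charts_at_def)
qed

lemma some_chart_in_charts_at: "c \<in> charts_at M p \<Longrightarrow> some_chart M p \<in> charts_at M p"
  unfolding some_chart_def by (rule someI)

lemma transition_differentiable:
  assumes "smooth_manifold M" "c \<in> charts_at M p" "d \<in> charts_at M p"
  shows "(chart_map d \<circ> chart_inv c) differentiable (at (chart_map c p))"
proof (rule smooth_on_differentiable)
  show "smooth_on (chart_map d \<circ> chart_inv c) (chart_map c ` (chart_dom c \<inter> chart_dom d))"
    using assms by (auto simp: smooth_manifold_def charts_at_def)
qed (use assms in \<open>auto simp: charts_at_def\<close>)

text \<open>
  The target of \<open>f\<close> is an arbitrary normed space: the lemma is used for real functions, for chart
  maps (where it is the cocycle identity of the transition maps), and for a map between manifolds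
  followed by a chart map of the target.
\<close>

lemma change_of_chart:
  assumes M: "smooth_manifold M" and c: "c \<in> charts_at M p" and d: "d \<in> charts_at M p"
    and f: "(f \<circ> chart_inv d) differentiable (at (chart_map d p))"
  shows "(f \<circ> chart_inv c) differentiable (at (chart_map c p))"
    and "frechet_derivative (f \<circ> chart_inv c) (at (chart_map c p)) x =
         frechet_derivative (f \<circ> chart_inv d) (at (chart_map d p))
           (frechet_derivative (chart_map d \<circ> chart_inv c) (at (chart_map c p)) x)"
proof -
  let ?W = "chart_map c ` (chart_dom c \<inter> chart_dom d)"
  let ?g = "(f \<circ> chart_inv d) \<circ> (chart_map d \<circ> chart_inv c)"
  have ca: "c \<in> atlas M" "d \<in> atlas M" using c d by (auto simp: charts_at_def)
  have W: "open ?W" "chart_map c p \<in> ?W"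
    using c d by (auto intro!: open_chart_image[OF M ca(1)] openin_Int openin_chart_dom[OF M]
        simp: charts_at_def)
  have inv: "chart_inv c (chart_map c p) = p" by (rule chart_inv_chart_map[OF M c])
  have eq: "?g w = (f \<circ> chart_inv c) w" if "w \<in> ?W" for w
  proof -
    from that obtain q where q: "w = chart_map c q" "c \<in> charts_at M q" "d \<in> charts_at M q"
      using ca by (auto simp: charts_at_def)
    then show ?thesis by (simp add: chart_inv_chart_map[OF M])
  qed
  have t: "(chart_map d \<circ> chart_inv c) differentiable (at (chart_map c p))"
    by (rule transition_differentiable[OF M c d])
  have f': "(f \<circ> chart_inv d) differentiable (at ((chart_map d \<circ> chart_inv c) (chart_map c p)))"
    using f inv by simp
  have g: "?g differentiable (at (chart_map c p))"
    by (rule differentiable_chain_at[OF t f'])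
  show "(f \<circ> chart_inv c) differentiable (at (chart_map c p))"
    by (rule differentiable_transform_open[OF g W eq])
  have "frechet_derivative (f \<circ> chart_inv c) (at (chart_map c p)) =
      frechet_derivative ?g (at (chart_map c p))"
    by (rule frechet_derivative_transform_within_open[OF g W eq, symmetric])
  also have "\<dots> = frechet_derivative (f \<circ> chart_inv d) (at (chart_map d p)) \<circ>
      frechet_derivative (chart_map d \<circ> chart_inv c) (at (chart_map c p))"
    by (subst frechet_derivative_compose[OF t f']) (simp only: o_apply inv)
  finally show "frechet_derivative (f \<circ> chart_inv c) (at (chart_map c p)) x =
         frechet_derivative (f \<circ> chart_inv d) (at (chart_map d p))
           (frechet_derivative (chart_map d \<circ> chart_inv c) (at (chart_map c p)) x)"
    by simp
qed

lemma coord_vector_self: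
  assumes M: "smooth_manifold M" and c: "c \<in> charts_at M p"
  shows "coord_vector M p c x c = x"
proof -
  have ca: "c \<in> atlas M" using c by (auto simp: charts_at_def)
  have W: "open (chart_map c ` chart_dom c)" "chart_map c p \<in> chart_map c ` chart_dom c"
    using c by (auto intro!: open_chart_image[OF M ca] openin_chart_dom[OF M] simp: charts_at_def)
  have "w = (chart_map c \<circ> chart_inv c) w" if "w \<in> chart_map c ` chart_dom c" for w
    using that ca by (auto simp: charts_at_def intro!: chart_inv_chart_map[OF M, symmetric] arg_cong[of _ _ "chart_map c"])
  then have "frechet_derivative (\<lambda>w. w) (at (chart_map c p)) =
      frechet_derivative (chart_map c \<circ> chart_inv c) (at (chart_map c p))"
    by (intro frechet_derivative_transform_within_open[OF _ W]) auto
  then show ?thesis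
    using c by (simp add: coord_vector_def flip: id_def)
qed

lemma coord_vector_in_tangent_space:
  assumes M: "smooth_manifold M" and c: "c \<in> charts_at M p"
  shows "coord_vector M p c x \<in> tangent_space M p"
  unfolding tangent_space_def
proof (intro CollectI conjI ballI allI impI)
  fix d d' assume "d \<in> charts_at M p" "d' \<in> charts_at M p"
  then show "coord_vector M p c x d' =
      frechet_derivative (chart_map d' \<circ> chart_inv d) (at (chart_map d p)) (coord_vector M p c x d)"
    using change_of_chart(2)[OF M c, of d "chart_map d'"] transition_differentiable[OF M]
    by (simp add: coord_vector_def)
qed (simp add: coord_vector_def)

text \<open>
  Together with \<open>coord_vector_self\<close> and \<open>coord_vector_in_tangent_space\<close> this identifies the
  tangent space with the coordinate space of any chart around the point.
\<close>

lemma coord_vector_tangent: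
  assumes "c \<in> charts_at M p" "v \<in> tangent_space M p"
  shows "coord_vector M p c (v c) = v"
proof
  fix d
  have "d \<in> charts_at M p \<Longrightarrow>
      v d = frechet_derivative (chart_map d \<circ> chart_inv c) (at (chart_map c p)) (v c)"
    and "d \<notin> charts_at M p \<Longrightarrow> v d = 0"
    using assms unfolding tangent_space_def by blast+
  then show "coord_vector M p c (v c) d = v d"
    unfolding coord_vector_def by presburger
qed

lemma linear_coord_vector:
  assumes M: "smooth_manifold M" and c: "c \<in> charts_at M p"
  shows "linear (\<lambda>x. coord_vector M p c x d)"
proof (cases "d \<in> charts_at M p")
  case True
  then show ?thesis
    using linear_frechet_derivative[OF transition_differentiable[OF M c True]]
    by (simp add: coord_vector_def)
next
  case False
  then show ?thesis by (simp add: coord_vector_def linear_zero)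
qed

lemma coord_vector_add:
  assumes "smooth_manifold M" "c \<in> charts_at M p"
  shows "coord_vector M p c (x + y) = (\<lambda>d. coord_vector M p c x d + coord_vector M p c y d)"
  using linear_add[OF linear_coord_vector[OF assms]] by blast

lemma coord_vector_scaleR:
  assumes "smooth_manifold M" "c \<in> charts_at M p"
  shows "coord_vector M p c (a *\<^sub>R x) = (\<lambda>d. a *\<^sub>R coord_vector M p c x d)"
  using linear_scale[OF linear_coord_vector[OF assms]] by blast

lemma zero_in_tangent_space:
  assumes M: "smooth_manifold M" and p: "p \<in> points M"
  shows "(\<lambda>_. 0) \<in> tangent_space M p"
proof -
  obtain c where c: "c \<in> charts_at M p" by (rule charts_at_nonempty[OF M p])
  have "coord_vector M p c 0 = (\<lambda>_. 0)"
    using coord_vector_scaleR[OF M c, of 0] by simp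
  then show ?thesis using coord_vector_in_tangent_space[OF M c, of 0] by simp
qed

section \<open>The metric in a chart\<close>

text \<open>The metric at the point with coordinates \<open>z\<close>, as a bilinear form on coordinate vectors.\<close>

definition local_metric ::
    "('a, 'e::euclidean_space) riem \<Rightarrow> ('a, 'e) chart \<Rightarrow> 'e \<Rightarrow> 'e \<Rightarrow> 'e \<Rightarrow> real" where
  "local_metric M c z x y =
     metric M (chart_inv c z) (coord_vector M (chart_inv c z) c x) (coord_vector M (chart_inv c z) c y)"

lemma riemannian_manifold_smooth: "riemannian_manifold M \<Longrightarrow> smooth_manifold M"
  by (simp add: riemannian_manifold_def)

lemma charts_at_points:
  assumes "smooth_manifold M" "c \<in> charts_at M p"
  shows "p \<in> points M"
  using assms openin_subset[OF openin_chart_dom] by (fastforce simp: charts_at_def)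

lemma metric_eq_local_metric:
  assumes M: "riemannian_manifold M" and c: "c \<in> charts_at M p"
    and "u \<in> tangent_space M p" "v \<in> tangent_space M p"
  shows "metric M p u v = local_metric M c (chart_map c p) (u c) (v c)"
  using assms by (simp add: local_metric_def chart_inv_chart_map[OF riemannian_manifold_smooth]
      coord_vector_tangent)

lemma local_metric_differentiable:
  assumes "riemannian_manifold M" "c \<in> charts_at M p"
  shows "(\<lambda>z. local_metric M c z x y) differentiable (at (chart_map c p))"
proof (rule smooth_on_differentiable)
  show "smooth_on (\<lambda>z. local_metric M c z x y) (chart_map c ` chart_dom c)"
    using assms unfolding riemannian_manifold_def local_metric_def charts_at_def by blast
qed (use assms in \<open>auto simp: charts_at_def\<close>)

lemma inner_form_local_metric:
  assumes R: "riemannian_manifold M" and c: "c \<in> charts_at M p"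
  shows "inner_form (local_metric M c (chart_map c p))"
proof -
  have M: "smooth_manifold M" by (rule riemannian_manifold_smooth[OF R])
  have p: "p \<in> points M" by (rule charts_at_points[OF M c])
  let ?v = "coord_vector M p c"
  have T: "?v x \<in> tangent_space M p" for x
    by (rule coord_vector_in_tangent_space[OF M c])
  have B: "local_metric M c (chart_map c p) x y = metric M p (?v x) (?v y)" for x y
    by (simp add: local_metric_def chart_inv_chart_map[OF M c])
  have sym: "metric M p u v = metric M p v u" and
    add: "metric M p (\<lambda>c. u c + v c) w = metric M p u w + metric M p v w" and
    scale: "metric M p (\<lambda>c. a *\<^sub>R u c) v = a * metric M p u v" and
    pos: "u \<noteq> (\<lambda>_. 0) \<Longrightarrow> metric M p u u > 0"
    if "u \<in> tangent_space M p" "v \<in> tangent_space M p" "w \<in> tangent_space M p" for u v w a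
    using R p that unfolding riemannian_manifold_def by blast+
  have l: "linear (\<lambda>x. metric M p (?v x) (?v y))" for y
    by (intro linearI) (simp_all add: coord_vector_add[OF M c] coord_vector_scaleR[OF M c] add[OF T T T] scale[OF T T T])
  then have r: "linear (\<lambda>y. metric M p (?v x) (?v y))" for x
    by (subst sym[OF T T T]) auto
  have "metric M p (?v x) (?v x) > 0" if "x \<noteq> 0" for x
  proof (rule pos[OF T T T])
    show "?v x \<noteq> (\<lambda>_. 0)"
      using that coord_vector_self[OF M c, of x] by auto
  qed
  then show ?thesis
    unfolding inner_form_def bilinear_def B using l r sym[OF T T T] by blast
qed

lemma orthonormal_basis_frame:
  fixes M :: "('a, 'e::euclidean_space) riem"
  assumes R: "riemannian_manifold M" and c: "c \<in> charts_at M p" and e: "orthonormal_basis M p e"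
  shows "orthonormal_frame (local_metric M c (chart_map c p)) (\<lambda>i. e i c)"
  unfolding orthonormal_frame_def
proof
  have T: "e i \<in> tangent_space M p" if "i < DIM('e)" for i
    using e that by (simp add: orthonormal_basis_def)
  then show "\<forall>i<DIM('e). \<forall>j<DIM('e).
      local_metric M c (chart_map c p) (e i c) (e j c) = (if i = j then 1 else 0)"
    using e by (simp add: orthonormal_basis_def flip: metric_eq_local_metric[OF R c])
  have M: "smooth_manifold M" by (rule riemannian_manifold_smooth[OF R])
  have "x \<in> span ((\<lambda>i. e i c) ` {..<DIM('e)})" for x
  proof -
    obtain a where "coord_vector M p c x = (\<lambda>d. \<Sum>i<DIM('e). a i *\<^sub>R e i d)"
      using e coord_vector_in_tangent_space[OF M c] unfolding orthonormal_basis_def by blast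
    then have "x = (\<Sum>i<DIM('e). a i *\<^sub>R e i c)"
      using coord_vector_self[OF M c, of x] by simp
    moreover have "(\<Sum>i<DIM('e). a i *\<^sub>R e i c) \<in> span ((\<lambda>i. e i c) ` {..<DIM('e)})"
      by (intro span_sum span_scale span_base) auto
    ultimately show ?thesis by simp
  qed
  then show "span ((\<lambda>i. e i c) ` {..<DIM('e)}) = UNIV" by blast
qed

lemma frame_orthonormal_basis:
  fixes M :: "('a, 'e::euclidean_space) riem"
  assumes R: "riemannian_manifold M" and c: "c \<in> charts_at M p"
    and f: "orthonormal_frame (local_metric M c (chart_map c p)) f"
  shows "orthonormal_basis M p (\<lambda>i. coord_vector M p c (f i))"
  unfolding orthonormal_basis_def
proof (intro conjI allI impI ballI)
  have M: "smooth_manifold M" by (rule riemannian_manifold_smooth[OF R])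
  note T = coord_vector_in_tangent_space[OF M c]
  show "coord_vector M p c (f i) \<in> tangent_space M p" for i by (rule T)
  show "metric M p (coord_vector M p c (f i)) (coord_vector M p c (f j)) = (if i = j then 1 else 0)"
    if "i < DIM('e)" "j < DIM('e)" for i j
    using f that
    by (simp add: metric_eq_local_metric[OF R c T T] coord_vector_self[OF M c] orthonormal_frame_def)
  fix v assume v: "v \<in> tangent_space M p"
  let ?B = "local_metric M c (chart_map c p)"
  have bil: "bilinear ?B"
    using inner_form_local_metric[OF R c] by (simp add: inner_form_def)
  have "v d = (\<Sum>i<DIM('e). ?B (v c) (f i) *\<^sub>R coord_vector M p c (f i) d)" for d
  proof -
    interpret linear "\<lambda>x. coord_vector M p c x d" by (rule linear_coord_vector[OF M c])
    have "v d = coord_vector M p c (v c) d"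
      by (simp add: coord_vector_tangent[OF c v])
    also have "\<dots> = coord_vector M p c (\<Sum>i<DIM('e). ?B (v c) (f i) *\<^sub>R f i) d"
      using orthonormal_frame_expansion[OF bil f, of "v c"] by simp
    finally show ?thesis by (simp add: sum scale)
  qed
  then show "\<exists>a. v = (\<lambda>d. \<Sum>i<DIM('e). a i *\<^sub>R coord_vector M p c (f i) d)"
    by (intro exI[of _ "\<lambda>i. ?B (v c) (f i)"] ext)
qed

lemma orthonormal_basis_exists:
  assumes R: "riemannian_manifold M" and p: "p \<in> points M"
  obtains e where "orthonormal_basis M p e"
proof -
  obtain c where c: "c \<in> charts_at M p"
    by (rule charts_at_nonempty[OF riemannian_manifold_smooth[OF R] p])
  obtain e where "orthonormal_frame (local_metric M c (chart_map c p)) (\<lambda>i. e i (0::real))"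
    by (rule differentiable_orthonormal_frame[of "UNIV::real set" "\<lambda>_. local_metric M c (chart_map c p)"])
       (use inner_form_local_metric[OF R c] in auto)
  from frame_orthonormal_basis[OF R c this] show thesis by (rule that)
qed

section \<open>The differential and the energy density in charts\<close>

lemma C2_map_points:
  "C2_map M N \<psi> \<Longrightarrow> p \<in> points M \<Longrightarrow> \<psi> p \<in> points N"
  unfolding C2_map_def by (auto dest: continuous_map_image_subset_topspace)

lemma C2_map_open_domain:
  assumes M: "smooth_manifold M" and \<psi>: "C2_map M N \<psi>"
    and c: "c \<in> atlas M" and V: "openin (mtop N) V"
  shows "open (chart_map c ` {p \<in> chart_dom c. \<psi> p \<in> V})"
  using openin_continuous_map_preimage_gen[OF _ openin_chart_dom[OF M c] V] \<psi>
  by (intro open_chart_image[OF M c]) (auto simp: C2_map_def)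

lemma C2_map_differentiable:
  assumes \<psi>: "C2_map M N \<psi>" and c: "c \<in> charts_at M p" and d: "d \<in> charts_at N (\<psi> p)"
  shows "(chart_map d \<circ> \<psi> \<circ> chart_inv c) differentiable (at (chart_map c p))"
    and "(\<lambda>z. frechet_derivative (chart_map d \<circ> \<psi> \<circ> chart_inv c) (at z) x)
           differentiable (at (chart_map c p))"
proof -
  have "Ck_on 2 (chart_map d \<circ> \<psi> \<circ> chart_inv c)
          (chart_map c ` {p \<in> chart_dom c. \<psi> p \<in> chart_dom d})"
    and "chart_map c p \<in> chart_map c ` {p \<in> chart_dom c. \<psi> p \<in> chart_dom d}"
    using assms by (auto simp: C2_map_def charts_at_def)
  then show "(chart_map d \<circ> \<psi> \<circ> chart_inv c) differentiable (at (chart_map c p))"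
    and "(\<lambda>z. frechet_derivative (chart_map d \<circ> \<psi> \<circ> chart_inv c) (at z) x)
           differentiable (at (chart_map c p))"
    by (rule Ck_on_2_differentiable)+
qed

lemma differential_in_charts:
  assumes M: "smooth_manifold M" and N: "smooth_manifold N" and \<psi>: "C2_map M N \<psi>"
    and c: "c \<in> charts_at M p" and d: "d \<in> charts_at N (\<psi> p)" and v: "v \<in> tangent_space M p"
  shows "differential M N \<psi> p v =
    coord_vector N (\<psi> p) d
      (frechet_derivative (chart_map d \<circ> \<psi> \<circ> chart_inv c) (at (chart_map c p)) (v c))"
proof
  fix d'
  let ?s = "some_chart M p"
  let ?F = "chart_map d \<circ> \<psi> \<circ> chart_inv c"
  have s: "?s \<in> charts_at M p" by (rule some_chart_in_charts_at[OF c])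
  have ca: "c \<in> atlas M" "d \<in> atlas N" using c d by (auto simp: charts_at_def)
  show "differential M N \<psi> p v d' = coord_vector N (\<psi> p) d (frechet_derivative ?F (at (chart_map c p)) (v c)) d'"
  proof (cases "d' \<in> charts_at N (\<psi> p)")
    case False
    then show ?thesis by (simp add: differential_def coord_vector_def Let_def)
  next
    case True
    let ?D = "frechet_derivative (chart_map d' \<circ> \<psi> \<circ> chart_inv c) (at (chart_map c p))"
    have vc: "v c = frechet_derivative (chart_map c \<circ> chart_inv ?s) (at (chart_map ?s p)) (v ?s)"
      using v s c unfolding tangent_space_def by blast
    have "differential M N \<psi> p v d' =
        frechet_derivative (chart_map d' \<circ> \<psi> \<circ> chart_inv ?s) (at (chart_map ?s p)) (v ?s)"
      using True by (simp add: differential_def Let_def)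
    also have "\<dots> = ?D (v c)"
      unfolding vc by (rule change_of_chart(2)[OF M s c C2_map_differentiable(1)[OF \<psi> c True]])
    finally have 1: "differential M N \<psi> p v d' = ?D (v c)" .
    let ?T = "chart_map d' \<circ> chart_inv d"
    let ?W = "chart_map c ` {q \<in> chart_dom c. \<psi> q \<in> chart_dom d}"
    have W: "open ?W" "chart_map c p \<in> ?W"
      using c d C2_map_open_domain[OF M \<psi> ca(1) openin_chart_dom[OF N ca(2)]]
      by (auto simp: charts_at_def)
    have F: "?F differentiable (at (chart_map c p))"
      by (rule C2_map_differentiable(1)[OF \<psi> c d])
    have Fp: "?F (chart_map c p) = chart_map d (\<psi> p)"
      by (simp add: chart_inv_chart_map[OF M c])
    have T: "?T differentiable (at (?F (chart_map c p)))"
      unfolding Fp by (rule transition_differentiable[OF N d True])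
    have eq: "(?T \<circ> ?F) w = (chart_map d' \<circ> \<psi> \<circ> chart_inv c) w" if "w \<in> ?W" for w
    proof -
      from that obtain q where q: "w = chart_map c q" "c \<in> charts_at M q" "d \<in> charts_at N (\<psi> q)"
        using ca by (auto simp: charts_at_def)
      then show ?thesis by (simp add: chart_inv_chart_map[OF M] chart_inv_chart_map[OF N])
    qed
    have "?D = frechet_derivative (?T \<circ> ?F) (at (chart_map c p))"
      by (rule frechet_derivative_transform_within_open[OF differentiable_chain_at[OF F T] W eq, symmetric])
    also have "\<dots> = frechet_derivative ?T (at (chart_map d (\<psi> p))) \<circ> frechet_derivative ?F (at (chart_map c p))"
      by (subst frechet_derivative_compose[OF F T]) (simp only: Fp)
    finally show ?thesis
      using True by (simp add: 1 coord_vector_def)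
  qed
qed

lemma metric_differential_in_charts:
  assumes R: "riemannian_manifold M" and S: "riemannian_manifold N" and \<psi>: "C2_map M N \<psi>"
    and c: "c \<in> charts_at M p" and d: "d \<in> charts_at N (\<psi> p)"
    and u: "u \<in> tangent_space M p" and v: "v \<in> tangent_space M p"
  shows "metric N (\<psi> p) (differential M N \<psi> p u) (differential M N \<psi> p v) =
    local_metric N d (chart_map d (\<psi> p))
      (frechet_derivative (chart_map d \<circ> \<psi> \<circ> chart_inv c) (at (chart_map c p)) (u c))
      (frechet_derivative (chart_map d \<circ> \<psi> \<circ> chart_inv c) (at (chart_map c p)) (v c))"
proof -
  note M = riemannian_manifold_smooth[OF R] and N = riemannian_manifold_smooth[OF S]
  show ?thesis
    unfolding differential_in_charts[OF M N \<psi> c d u] differential_in_charts[OF M N \<psi> c d v]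
    by (subst metric_eq_local_metric[OF S d])
       (simp_all add: coord_vector_in_tangent_space[OF N d] coord_vector_self[OF N d])
qed

text \<open>
  The energy density is the trace of the pulled back metric, so it can be computed in
  any frame that is orthonormal for the metric in a chart.
\<close>

lemma energy_density_in_charts:
  fixes M :: "('a, 'e::euclidean_space) riem" and N :: "('b, 'f::euclidean_space) riem"
  assumes R: "riemannian_manifold M" and S: "riemannian_manifold N" and \<psi>: "C2_map M N \<psi>"
    and c: "c \<in> charts_at M p" and d: "d \<in> charts_at N (\<psi> p)"
    and f: "orthonormal_frame (local_metric M c (chart_map c p)) f"
  shows "energy_density M N \<psi> p =
    (\<Sum>i<DIM('e). local_metric N d (chart_map d (\<psi> p))
      (frechet_derivative (chart_map d \<circ> \<psi> \<circ> chart_inv c) (at (chart_map c p)) (f i))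
      (frechet_derivative (chart_map d \<circ> \<psi> \<circ> chart_inv c) (at (chart_map c p)) (f i)))"
proof -
  let ?D = "frechet_derivative (chart_map d \<circ> \<psi> \<circ> chart_inv c) (at (chart_map c p))"
  let ?H = "\<lambda>x y. local_metric N d (chart_map d (\<psi> p)) (?D x) (?D y)"
  define e where "e = (SOME e. orthonormal_basis M p e)"
  have e: "orthonormal_basis M p e"
    unfolding e_def
    by (rule someI[of "orthonormal_basis M p"]) (rule frame_orthonormal_basis[OF R c f])
  have T: "e i \<in> tangent_space M p" if "i < DIM('e)" for i
    using e that by (simp add: orthonormal_basis_def)
  have D: "linear ?D"
    by (rule linear_frechet_derivative[OF C2_map_differentiable(1)[OF \<psi> c d]])
  have h: "bilinear (local_metric N d (chart_map d (\<psi> p)))"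
    using inner_form_local_metric[OF S d] by (simp add: inner_form_def)
  have H: "bilinear ?H"
    unfolding bilinear_def
    using h D by (auto simp: bilinear_def intro!: linearI
        simp: linear_add[OF D] linear_scale[OF D] bilinear_ladd[OF h] bilinear_radd[OF h]
          bilinear_lmul[OF h] bilinear_rmul[OF h])
  have "energy_density M N \<psi> p = (\<Sum>i<DIM('e). ?H (e i c) (e i c))"
    unfolding energy_density_def e_def[symmetric] Let_def
    using metric_differential_in_charts[OF R S \<psi> c d T T] by (intro sum.cong) auto
  also have "\<dots> = (\<Sum>i<DIM('e). ?H (f i) (f i))"
    by (rule trace_frame_independent[OF inner_form_local_metric[OF R c] H
          orthonormal_basis_frame[OF R c e] f])
  finally show ?thesis .
qed

text \<open>The derivatives of \<open>\<psi>\<close> enter the energy density, hence the need for class \<open>C\<^sup>2\<close>.\<close>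

lemma energy_density_differentiable:
  fixes M :: "('a, 'e::euclidean_space) riem" and N :: "('b, 'f::euclidean_space) riem"
  assumes R: "riemannian_manifold M" and S: "riemannian_manifold N" and \<psi>: "C2_map M N \<psi>"
    and c: "c \<in> charts_at M p"
  shows "(energy_density M N \<psi> \<circ> chart_inv c) differentiable (at (chart_map c p))"
proof -
  note M = riemannian_manifold_smooth[OF R] and N = riemannian_manifold_smooth[OF S]
  have p: "p \<in> points M" by (rule charts_at_points[OF M c])
  obtain d where d: "d \<in> charts_at N (\<psi> p)"
    by (rule charts_at_nonempty[OF N C2_map_points[OF \<psi> p]])
  have ca: "c \<in> atlas M" "d \<in> atlas N" using c d by (auto simp: charts_at_def)
  let ?F = "chart_map d \<circ> \<psi> \<circ> chart_inv c"
  let ?W = "chart_map c ` {q \<in> chart_dom c. \<psi> q \<in> chart_dom d}"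
  have W: "open ?W" "chart_map c p \<in> ?W"
    using c d C2_map_open_domain[OF M \<psi> ca(1) openin_chart_dom[OF N ca(2)]]
    by (auto simp: charts_at_def)
  have W_charts: "\<exists>q. w = chart_map c q \<and> c \<in> charts_at M q \<and> d \<in> charts_at N (\<psi> q)"
    if "w \<in> ?W" for w
    using that ca by (auto simp: charts_at_def)
  have form: "inner_form (local_metric M c w)" if "w \<in> ?W" for w
    using W_charts[OF that] inner_form_local_metric[OF R] by blast
  have diff: "(\<lambda>w. local_metric M c w x y) differentiable (at w)" if "w \<in> ?W" for w x y
    using W_charts[OF that] local_metric_differentiable[OF R] by blast
  obtain e where e: "\<forall>w\<in>?W. orthonormal_frame (local_metric M c w) (\<lambda>i. e i w)"
    and ediff: "\<forall>i<DIM('e). \<forall>w\<in>?W. e i differentiable (at w)"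
    by (rule differentiable_orthonormal_frame[OF W(1) form diff])
  let ?D = "\<lambda>w. frechet_derivative ?F (at w)"
  have E: "(\<Sum>i<DIM('e). local_metric N d (?F w) (?D w (e i w)) (?D w (e i w))) =
      (energy_density M N \<psi> \<circ> chart_inv c) w" if w: "w \<in> ?W" for w
  proof -
    from W_charts[OF w] obtain q where
      q: "w = chart_map c q" "c \<in> charts_at M q" "d \<in> charts_at N (\<psi> q)" by blast
    have "chart_inv c w = q" "?F w = chart_map d (\<psi> q)"
      using q by (simp_all add: chart_inv_chart_map[OF M])
    then show ?thesis
      using energy_density_in_charts[OF R S \<psi> q(2,3)] bspec[OF e w] q(1) by simp
  qed
  have Ddiff: "(\<lambda>w. ?D w (e i w)) differentiable (at (chart_map c p))" if "i < DIM('e)" for i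
  proof (rule differentiable_linear_apply[OF W _ C2_map_differentiable(2)[OF \<psi> c d] ediff[rule_format, OF that W(2)]])
    fix w assume "w \<in> ?W"
    from W_charts[OF this] obtain q where
      q: "w = chart_map c q" "c \<in> charts_at M q" "d \<in> charts_at N (\<psi> q)" by blast
    show "linear (?D w)"
      unfolding q(1) by (rule linear_frechet_derivative[OF C2_map_differentiable(1)[OF \<psi> q(2,3)]])
  qed
  have hdiff: "(\<lambda>w. local_metric N d (?F w) x y) differentiable (at (chart_map c p))" for x y
  proof (rule differentiable_compose[of "\<lambda>z. local_metric N d z x y" ?F])
    show "(\<lambda>z. local_metric N d z x y) differentiable (at (?F (chart_map c p)))"
      using local_metric_differentiable[OF S d] by (simp add: chart_inv_chart_map[OF M c])
  qed (rule C2_map_differentiable(1)[OF \<psi> c d])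
  have hbil: "bilinear (local_metric N d (?F w))" if "w \<in> ?W" for w
  proof -
    from W_charts[OF that] obtain q where
      q: "w = chart_map c q" "c \<in> charts_at M q" "d \<in> charts_at N (\<psi> q)" by blast
    then show ?thesis
      using inner_form_local_metric[OF S q(3)]
      by (simp add: inner_form_def chart_inv_chart_map[OF M])
  qed
  have "(\<lambda>w. local_metric N d (?F w) (?D w (e i w)) (?D w (e i w))) differentiable (at (chart_map c p))"
    if "i < DIM('e)" for i
    by (rule differentiable_bilinear_apply[OF W hbil hdiff Ddiff[OF that] Ddiff[OF that]])
  then have "(\<lambda>w. \<Sum>i<DIM('e). local_metric N d (?F w) (?D w (e i w)) (?D w (e i w)))
      differentiable (at (chart_map c p))"
    by (intro differentiable_sum) auto
  then show ?thesis
    by (rule differentiable_transform_open[OF _ W E])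
qed

section \<open>Functions with vanishing gradient\<close>

lemma fun_differential_in_charts:
  assumes M: "smooth_manifold M" and c: "c \<in> charts_at M p" and v: "v \<in> tangent_space M p"
    and f: "(f \<circ> chart_inv c) differentiable (at (chart_map c p))"
  shows "fun_differential M f p v = frechet_derivative (f \<circ> chart_inv c) (at (chart_map c p)) (v c)"
proof -
  let ?s = "some_chart M p"
  have s: "?s \<in> charts_at M p" by (rule some_chart_in_charts_at[OF c])
  have vc: "v c = frechet_derivative (chart_map c \<circ> chart_inv ?s) (at (chart_map ?s p)) (v ?s)"
    using v s c unfolding tangent_space_def by blast
  have "fun_differential M f p v = frechet_derivative (f \<circ> chart_inv ?s) (at (chart_map ?s p)) (v ?s)"
    by (simp add: fun_differential_def Let_def)
  also have "\<dots> = frechet_derivative (f \<circ> chart_inv c) (at (chart_map c p)) (v c)"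
    unfolding vc by (rule change_of_chart(2)[OF M s c f])
  finally show ?thesis .
qed

text \<open>The gradient exists and is unique where \<open>f\<close> is differentiable in one chart.\<close>

lemma grad_properties:
  fixes M :: "('a, 'e::euclidean_space) riem"
  assumes R: "riemannian_manifold M" and c: "c \<in> charts_at M p"
    and f: "(f \<circ> chart_inv c) differentiable (at (chart_map c p))"
  shows "grad M f p \<in> tangent_space M p"
    and "v \<in> tangent_space M p \<Longrightarrow> metric M p (grad M f p) v = fun_differential M f p v"
proof -
  note M = riemannian_manifold_smooth[OF R]
  let ?B = "local_metric M c (chart_map c p)"
  let ?l = "frechet_derivative (f \<circ> chart_inv c) (at (chart_map c p))"
  let ?P = "\<lambda>w. w \<in> tangent_space M p \<and> (\<forall>v\<in>tangent_space M p. metric M p w v = fun_differential M f p v)"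
  have form: "inner_form ?B" by (rule inner_form_local_metric[OF R c])
  then have bil: "bilinear ?B" and sym: "\<And>x y. ?B x y = ?B y x"
    and pos: "\<And>x. x \<noteq> 0 \<Longrightarrow> ?B x x > 0" by (auto simp: inner_form_def)
  interpret l: linear ?l by (rule linear_frechet_derivative[OF f])
  obtain b where "orthonormal_basis M p b"
    by (rule orthonormal_basis_exists[OF R charts_at_points[OF M c]])
  then have b: "orthonormal_frame ?B (\<lambda>i. b i c)"
    by (rule orthonormal_basis_frame[OF R c])
  note T = coord_vector_in_tangent_space[OF M c]
  have "\<exists>!w. ?P w"
  proof (rule ex_ex1I)
    \<comment> \<open>The Riesz representative of the derivative, in an orthonormal basis.\<close>
    define x where "x = (\<Sum>i<DIM('e). ?l (b i c) *\<^sub>R b i c)"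
    have "metric M p (coord_vector M p c x) v = fun_differential M f p v"
      if v: "v \<in> tangent_space M p" for v
    proof -
      have "metric M p (coord_vector M p c x) v = ?B x (v c)"
        by (simp add: metric_eq_local_metric[OF R c T v] coord_vector_self[OF M c])
      also have "\<dots> = (\<Sum>i<DIM('e). ?B (v c) (b i c) * ?l (b i c))"
        by (simp add: x_def bilinear_left_sum[OF bil] bilinear_lmul[OF bil] sym[of "v c"] mult.commute)
      also have "\<dots> = ?l (\<Sum>i<DIM('e). ?B (v c) (b i c) *\<^sub>R b i c)"
        by (simp add: l.sum l.scale)
      also have "\<dots> = ?l (v c)"
        by (simp flip: orthonormal_frame_expansion[OF bil b])
      also have "\<dots> = fun_differential M f p v"
        by (rule fun_differential_in_charts[OF M c v f, symmetric])
      finally show ?thesis .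
    qed
    then show "\<exists>w. ?P w" using T by blast
  next
    fix w' w assume w': "?P w'" and w: "?P w"
    show "w' = w"
    proof -
      have "?B (w' c) y = ?B (w c) y" for y
      proof -
        have "metric M p w' (coord_vector M p c y) = metric M p w (coord_vector M p c y)"
          using w w' T by simp
        then show ?thesis
          using w w' by (simp add: metric_eq_local_metric[OF R c _ T] coord_vector_self[OF M c])
      qed
      then have "?B (w' c - w c) (w' c - w c) = 0"
        by (simp add: bilinear_lsub[OF bil])
      then have "w' c = w c" using pos[of "w' c - w c"] by auto
      then show ?thesis
        using coord_vector_tangent[OF c] w w' by metis
    qed
  qed
  then have "?P (grad M f p)" unfolding grad_def by (rule theI')
  then show "grad M f p \<in> tangent_space M p"
    and "v \<in> tangent_space M p \<Longrightarrow> metric M p (grad M f p) v = fun_differential M f p v"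
    by blast+
qed

lemma grad_eq_zero_iff:
  assumes R: "riemannian_manifold M" and c: "c \<in> charts_at M p"
    and f: "(f \<circ> chart_inv c) differentiable (at (chart_map c p))"
  shows "grad M f p = (\<lambda>_. 0) \<longleftrightarrow>
         frechet_derivative (f \<circ> chart_inv c) (at (chart_map c p)) = (\<lambda>_. 0)"
proof -
  note M = riemannian_manifold_smooth[OF R]
  let ?B = "local_metric M c (chart_map c p)"
  let ?l = "frechet_derivative (f \<circ> chart_inv c) (at (chart_map c p))"
  have bil: "bilinear ?B" and pos: "\<And>x. x \<noteq> 0 \<Longrightarrow> ?B x x > 0"
    using inner_form_local_metric[OF R c] by (auto simp: inner_form_def)
  note G = grad_properties[OF R c f]
  have l: "?l (v c) = ?B (grad M f p c) (v c)" if "v \<in> tangent_space M p" for v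
    using G(2)[OF that] fun_differential_in_charts[OF M c that f]
      metric_eq_local_metric[OF R c G(1) that] by simp
  show ?thesis
  proof
    assume z: "grad M f p = (\<lambda>_. 0)"
    show "?l = (\<lambda>_. 0)"
    proof
      fix x show "?l x = 0"
        using l[OF coord_vector_in_tangent_space[OF M c, of x]]
        by (simp add: coord_vector_self[OF M c] z bilinear_lzero[OF bil])
    qed
  next
    assume "?l = (\<lambda>_. 0)"
    then have "?B (grad M f p c) (grad M f p c) = 0" using l[OF G(1)] by simp
    then have "grad M f p c = 0" using pos by force
    then have "coord_vector M p c (grad M f p c) = coord_vector M p c (0 *\<^sub>R 0)" by simp
    then show "grad M f p = (\<lambda>_. 0)"
      unfolding coord_vector_scaleR[OF M c] coord_vector_tangent[OF c G(1)] by simp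
  qed
qed

lemma locally_constant_if_grad_zero:
  assumes R: "riemannian_manifold M" and c: "c \<in> charts_at M p"
    and f: "\<And>q. c \<in> charts_at M q \<Longrightarrow> (f \<circ> chart_inv c) differentiable (at (chart_map c q))"
    and g: "\<And>q. q \<in> points M \<Longrightarrow> grad M f q = (\<lambda>_. 0)"
  obtains U where "openin (mtop M) U" "p \<in> U" "\<forall>q\<in>U. f q = f p"
proof -
  note M = riemannian_manifold_smooth[OF R]
  have ca: "c \<in> atlas M" and pc: "p \<in> chart_dom c" using c by (auto simp: charts_at_def)
  have "open (chart_map c ` chart_dom c)" "chart_map c p \<in> chart_map c ` chart_dom c"
    using pc open_chart_image[OF M ca openin_chart_dom[OF M ca]] by auto
  then obtain r where r: "r > 0" "ball (chart_map c p) r \<subseteq> chart_map c ` chart_dom c"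
    using open_contains_ball by blast
  let ?A = "ball (chart_map c p) r"
  let ?U = "{q \<in> chart_dom c. chart_map c q \<in> ?A}"
  have "homeomorphic_map (subtopology (mtop M) (chart_dom c))
          (top_of_set (chart_map c ` chart_dom c)) (chart_map c)"
    using M ca by (simp add: smooth_manifold_def)
  then have "continuous_map (subtopology (mtop M) (chart_dom c))
          (top_of_set (chart_map c ` chart_dom c)) (chart_map c)"
    by (rule homeomorphic_imp_continuous_map)
  moreover have "openin (top_of_set (chart_map c ` chart_dom c)) ?A"
    using r(2) by (simp add: open_subset)
  ultimately have "openin (subtopology (mtop M) (chart_dom c))
      {q \<in> topspace (subtopology (mtop M) (chart_dom c)). chart_map c q \<in> ?A}"
    by (rule openin_continuous_map_preimage)
  moreover have "{q \<in> topspace (subtopology (mtop M) (chart_dom c)). chart_map c q \<in> ?A} = ?U"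
    using openin_subset[OF openin_chart_dom[OF M ca]] by auto
  ultimately have U: "openin (mtop M) ?U"
    using openin_trans_full[OF _ openin_chart_dom[OF M ca]] by metis
  have der: "((f \<circ> chart_inv c) has_derivative (\<lambda>_. 0)) (at z within ?A)" if "z \<in> ?A" for z
  proof -
    from that r(2) obtain q where q: "z = chart_map c q" "c \<in> charts_at M q"
      using ca by (auto simp: charts_at_def)
    have "frechet_derivative (f \<circ> chart_inv c) (at z) = (\<lambda>_. 0)"
      using grad_eq_zero_iff[OF R q(2) f[OF q(2)]] g[OF charts_at_points[OF M q(2)]] q(1) by simp
    then have "((f \<circ> chart_inv c) has_derivative (\<lambda>_. 0)) (at z)"
      using f[OF q(2)] q(1) frechet_derivative_works by metis
    then show ?thesis by (rule has_derivative_at_withinI)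
  qed
  have "f q = f p" if "q \<in> ?U" for q
  proof -
    have q: "c \<in> charts_at M q" using that ca by (simp add: charts_at_def)
    obtain k where "\<forall>z\<in>?A. (f \<circ> chart_inv c) z = k"
      using has_derivative_zero_constant[OF convex_ball der] by blast
    then have "(f \<circ> chart_inv c) (chart_map c q) = (f \<circ> chart_inv c) (chart_map c p)"
      using that r(1) by simp
    then show ?thesis
      by (simp add: chart_inv_chart_map[OF M q] chart_inv_chart_map[OF M c])
  qed
  then have "\<forall>q\<in>?U. f q = f p" by blast
  moreover have "p \<in> ?U" using pc r(1) by simp
  ultimately show thesis by (intro that[OF U])
qed

lemma locally_constant_imp_constant:
  assumes X: "connected_space X"
    and loc: "\<And>p. p \<in> topspace X \<Longrightarrow> \<exists>U. openin X U \<and> p \<in> U \<and> (\<forall>q\<in>U. f q = f p)"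
  shows "\<exists>k. \<forall>p\<in>topspace X. f p = k"
proof (cases "topspace X = {}")
  case False
  then obtain p where p: "p \<in> topspace X" by blast
  have o: "openin X {q \<in> topspace X. P (f q)}" for P
  proof (subst openin_subopen, clarify)
    fix q assume q: "q \<in> topspace X" "P (f q)"
    from loc[OF q(1)] obtain U where U: "openin X U" "q \<in> U" "\<forall>q'\<in>U. f q' = f q" by blast
    have "q' \<in> topspace X \<and> P (f q')" if "q' \<in> U" for q'
      using U(3)[rule_format, OF that] q(2) openin_subset[OF U(1)] that by auto
    then show "\<exists>T. openin X T \<and> q \<in> T \<and> T \<subseteq> {q \<in> topspace X. P (f q)}"
      using U(1,2) by blast
  qed
  let ?S = "{q \<in> topspace X. f q = f p}"
  have "topspace X - ?S = {q \<in> topspace X. f q \<noteq> f p}" by blast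
  then have "closedin X ?S" using o[of "\<lambda>y. y \<noteq> f p"] by (auto simp: closedin_def)
  then have "?S = {} \<or> ?S = topspace X"
    using X o[of "\<lambda>y. y = f p"] unfolding connected_space_clopen_in by blast
  then have "?S = topspace X" using p by blast
  then show ?thesis by blast
qed simp

lemma grad_zero_iff_constant:
  assumes R: "riemannian_manifold M" and conn: "connected_space (mtop M)"
    and f: "\<And>p c. c \<in> charts_at M p \<Longrightarrow> (f \<circ> chart_inv c) differentiable (at (chart_map c p))"
  shows "(\<forall>p\<in>points M. grad M f p = (\<lambda>_. 0)) \<longleftrightarrow> (\<exists>k. \<forall>p\<in>points M. f p = k)"
proof
  note M = riemannian_manifold_smooth[OF R]
  assume g: "\<forall>p\<in>points M. grad M f p = (\<lambda>_. 0)"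
  show "\<exists>k. \<forall>p\<in>points M. f p = k"
  proof (rule locally_constant_imp_constant[OF conn])
    fix p assume "p \<in> points M"
    then obtain c where c: "c \<in> charts_at M p" by (rule charts_at_nonempty[OF M])
    obtain U where "openin (mtop M) U" "p \<in> U" "\<forall>q\<in>U. f q = f p"
      by (rule locally_constant_if_grad_zero[OF R c f bspec[OF g]])
    then show "\<exists>U. openin (mtop M) U \<and> p \<in> U \<and> (\<forall>q\<in>U. f q = f p)"
      by blast
  qed
next
  note M = riemannian_manifold_smooth[OF R]
  assume "\<exists>k. \<forall>p\<in>points M. f p = k"
  then obtain k where k: "\<And>p. p \<in> points M \<Longrightarrow> f p = k" by blast
  show "\<forall>p\<in>points M. grad M f p = (\<lambda>_. 0)"
  proof
    fix p assume "p \<in> points M"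
    then obtain c where c: "c \<in> charts_at M p" by (rule charts_at_nonempty[OF M])
    have ca: "c \<in> atlas M" and pc: "p \<in> chart_dom c" using c by (auto simp: charts_at_def)
    let ?W = "chart_map c ` chart_dom c"
    have W: "open ?W" "chart_map c p \<in> ?W"
      using pc open_chart_image[OF M ca openin_chart_dom[OF M ca]] by auto
    have "k = (f \<circ> chart_inv c) z" if "z \<in> ?W" for z
    proof -
      from that obtain q where q: "z = chart_map c q" "c \<in> charts_at M q"
        using ca by (auto simp: charts_at_def)
      show ?thesis
        using k[OF charts_at_points[OF M q(2)]] by (simp add: q(1) chart_inv_chart_map[OF M q(2)])
    qed
    then have "frechet_derivative (\<lambda>_. k) (at (chart_map c p)) =
        frechet_derivative (f \<circ> chart_inv c) (at (chart_map c p))"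
      by (intro frechet_derivative_transform_within_open[OF _ W]) auto
    from this[symmetric] show "grad M f p = (\<lambda>_. 0)"
      unfolding grad_eq_zero_iff[OF R c f[OF c]] frechet_derivative_const .
  qed
qed

section \<open>Infinity-harmonic immersions\<close>

lemma differential_zero:
  assumes M: "smooth_manifold M" and N: "smooth_manifold N" and \<psi>: "C2_map M N \<psi>"
    and p: "p \<in> points M"
  shows "differential M N \<psi> p (\<lambda>_. 0) = (\<lambda>_. 0)"
proof -
  obtain c where c: "c \<in> charts_at M p" by (rule charts_at_nonempty[OF M p])
  obtain d where d: "d \<in> charts_at N (\<psi> p)"
    by (rule charts_at_nonempty[OF N C2_map_points[OF \<psi> p]])
  interpret linear "frechet_derivative (chart_map d \<circ> \<psi> \<circ> chart_inv c) (at (chart_map c p))"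
    by (rule linear_frechet_derivative[OF C2_map_differentiable(1)[OF \<psi> c d]])
  have "coord_vector N (\<psi> p) d 0 = (\<lambda>_. 0)"
    using coord_vector_scaleR[OF N d, of 0] by simp
  then show ?thesis
    by (simp add: differential_in_charts[OF M N \<psi> c d zero_in_tangent_space[OF M p]] zero)
qed

text \<open>
  Injectivity of the differentials turns the equation into the vanishing of the gradient of the
  energy density.
\<close>

lemma infinity_harmonic_immersion_iff:
  assumes R: "riemannian_manifold M" and conn: "connected_space (mtop M)"
    and S: "riemannian_manifold N" and imm: "immersion M N \<psi>"
  shows "infinity_harmonic M N \<psi> \<longleftrightarrow> (\<exists>k. \<forall>p\<in>points M. energy_density M N \<psi> p = k)"
proof -
  note M = riemannian_manifold_smooth[OF R] and N = riemannian_manifold_smooth[OF S]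
  let ?E = "energy_density M N \<psi>"
  have \<psi>: "C2_map M N \<psi>" using imm by (simp add: immersion_def)
  have E: "(?E \<circ> chart_inv c) differentiable (at (chart_map c p))" if "c \<in> charts_at M p" for p c
    by (rule energy_density_differentiable[OF R S \<psi> that])
  have "(\<lambda>d. (1/2) *\<^sub>R differential M N \<psi> p (grad M ?E p) d) = (\<lambda>_. 0) \<longleftrightarrow>
      grad M ?E p = (\<lambda>_. 0)" if p: "p \<in> points M" for p
  proof -
    obtain c where c: "c \<in> charts_at M p" by (rule charts_at_nonempty[OF M p])
    have G: "grad M ?E p \<in> tangent_space M p" by (rule grad_properties(1)[OF R c E[OF c]])
    have inj: "inj_on (differential M N \<psi> p) (tangent_space M p)"
      using imm p by (simp add: immersion_def)
    have "(\<lambda>d. (1/2) *\<^sub>R differential M N \<psi> p (grad M ?E p) d) = (\<lambda>_. 0) \<longleftrightarrow>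
        differential M N \<psi> p (grad M ?E p) = differential M N \<psi> p (\<lambda>_. 0)"
      by (simp add: differential_zero[OF M N \<psi> p] fun_eq_iff)
    also have "\<dots> \<longleftrightarrow> grad M ?E p = (\<lambda>_. 0)"
      by (rule inj_on_eq_iff[OF inj G zero_in_tangent_space[OF M p]])
    finally show ?thesis .
  qed
  then have "infinity_harmonic M N \<psi> \<longleftrightarrow> (\<forall>p\<in>points M. grad M ?E p = (\<lambda>_. 0))"
    using \<psi> by (simp add: infinity_harmonic_def)
  also have "\<dots> \<longleftrightarrow> (\<exists>k. \<forall>p\<in>points M. ?E p = k)"
    by (rule grad_zero_iff_constant[OF R conn E])
  finally show ?thesis .
qed

lemma energy_density_conformal:
  fixes M :: "('a, 'e::euclidean_space) riem"
  assumes R: "riemannian_manifold M" and conf: "conformal_with M N \<psi> l" and p: "p \<in> points M"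
  shows "energy_density M N \<psi> p = real DIM('e) * (l p)\<^sup>2"
proof -
  define e where "e = (SOME e. orthonormal_basis M p e)"
  obtain b where "orthonormal_basis M p b" by (rule orthonormal_basis_exists[OF R p])
  then have e: "orthonormal_basis M p e" unfolding e_def by (rule someI[of "orthonormal_basis M p"])
  have "energy_density M N \<psi> p =
      (\<Sum>i<DIM('e). metric N (\<psi> p) (differential M N \<psi> p (e i)) (differential M N \<psi> p (e i)))"
    by (simp add: energy_density_def e_def Let_def)
  also have "\<dots> = (\<Sum>i<DIM('e). (l p)\<^sup>2)"
    using e conf p by (intro sum.cong) (auto simp: orthonormal_basis_def conformal_with_def)
  finally show ?thesis by simp
qed

theorem proposition4p7:
  fixes M :: "('a, 'e::euclidean_space) riem"
    and N :: "('b, 'f::euclidean_space) riem"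
    and \<iota> :: "'a \<Rightarrow> 'b"
  assumes "riemannian_manifold M" and "connected_space (mtop M)"
    and "riemannian_manifold N"
  shows "(immersion M N \<iota> \<longrightarrow>
            (infinity_harmonic M N \<iota> \<longleftrightarrow>
              (\<exists>k. \<forall>p\<in>points M. energy_density M N \<iota> p = k))) \<and>
         (conformal_immersion M N \<iota> \<longrightarrow>
            (infinity_harmonic M N \<iota> \<longleftrightarrow> homothetic_immersion M N \<iota>))"
proof (intro conjI impI)
  assume "immersion M N \<iota>"
  then show "infinity_harmonic M N \<iota> \<longleftrightarrow> (\<exists>k. \<forall>p\<in>points M. energy_density M N \<iota> p = k)"
    by (rule infinity_harmonic_immersion_iff[OF assms])
next
  assume "conformal_immersion M N \<iota>"
  then obtain l where imm: "immersion M N \<iota>" and l: "conformal_with M N \<iota> l"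
    by (auto simp: conformal_immersion_def)
  note harmonic_iff = infinity_harmonic_immersion_iff[OF assms imm]
  show "infinity_harmonic M N \<iota> \<longleftrightarrow> homothetic_immersion M N \<iota>"
  proof
    assume "infinity_harmonic M N \<iota>"
    then obtain k where k: "\<And>p. p \<in> points M \<Longrightarrow> energy_density M N \<iota> p = k"
      using harmonic_iff by blast
    have "l p = sqrt (k / real DIM('e))" if "p \<in> points M" for p
    proof -
      have "k = real DIM('e) * (l p)\<^sup>2"
        using k[OF that] energy_density_conformal[OF assms(1) l that] by simp
      then have "k / real DIM('e) = (l p)\<^sup>2" by simp
      moreover have "l p > 0" using l that by (simp add: conformal_with_def)
      ultimately show ?thesis by simp
    qed
    then have "conformal_with M N \<iota> (\<lambda>_. sqrt (k / real DIM('e)))"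
      using l unfolding conformal_with_def by metis
    then show "homothetic_immersion M N \<iota>"
      using imm by (auto simp: homothetic_immersion_def)
  next
    assume "homothetic_immersion M N \<iota>"
    then obtain r where "conformal_with M N \<iota> (\<lambda>_. r)"
      by (auto simp: homothetic_immersion_def)
    then show "infinity_harmonic M N \<iota>"
      using harmonic_iff energy_density_conformal[OF assms(1)] by blast
  qed
qed

end
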